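(* Let $(X_i)_{i\in\mathbb{N}}$ be an i.i.d. sequence of real random variables on a probability space $(\Omega,\mathcal{F},\mathbb{P})$ with distribution function $F$, and let $\widehat F_n=\frac1n\sum_{i=1}^n \mathbf{1}_{[X_i,\infty)}$ be the empirical distribution function of $X_1,\dots,X_n$. Let $\phi$ be a weight function and $r\in[0,\frac12)$. If $\int_{-\infty}^\infty \phi(x)^{1/(1-r)}\,dF(x)<\infty$, then $$n^{r}\,\|\widehat F_n-F\|_{\phi}\longrightarrow 0\qquad \mathbb{P}\text{-a.s. as } n\to\infty.$$
   Context: A weight function is a continuous function $\phi:\mathbb{R}\to\mathbb{R}_+$ that is bounded away from zero (there is $\varepsilon>0$ with $\phi(x)\ge\varepsilon$ for all $x$) and u-shaped: there is $x_\phi\in\mathbb{R}$ such that $\phi$ is nonincreasing on $(-\infty,x_\phi]$ and nondecreasing on $[x_\phi,\infty)$. For a function $\psi:\mathbb{R}\to\mathbb{R}$, $\|\psi\|_\phi:=\sup_{x\in\mathbb{R}}|\psi(x)|\phi(x)$. *)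

theory Defs
  imports "HOL-Probability.Probability"
begin

definition weight_function :: "(real \<Rightarrow> real) \<Rightarrow> bool" where
  "weight_function \<phi> \<longleftrightarrow>
     continuous_on UNIV \<phi> \<and>
     (\<exists>\<epsilon>>0. \<forall>x. \<phi> x \<ge> \<epsilon>) \<and>
     (\<exists>x\<^sub>\<phi>. antimono_on {..x\<^sub>\<phi>} \<phi> \<and> mono_on {x\<^sub>\<phi>..} \<phi>)"

text \<open>The weighted supremum may be infinite, so it takes values in \<^typ>\<open>ennreal\<close>; a supremum in
  \<^typ>\<open>real\<close> would be unspecified for unbounded functions. For \<open>\<phi> \<ge> 0\<close> the coercion
  \<^const>\<open>ennreal\<close> does not truncate.\<close>

definition weighted_norm :: "(real \<Rightarrow> real) \<Rightarrow> (real \<Rightarrow> real) \<Rightarrow> ennreal" where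
  "weighted_norm \<phi> \<psi> = (SUP x. ennreal (\<bar>\<psi> x\<bar> * \<phi> x))"

definition empirical_cdf :: "(nat \<Rightarrow> 'a \<Rightarrow> real) \<Rightarrow> nat \<Rightarrow> 'a \<Rightarrow> real \<Rightarrow> real" where
  "empirical_cdf X n \<omega> x = 1 / real n * (\<Sum>i=1..n. indicator {X i \<omega>..} x)"

end

theory Submission
  imports Defs "HOL-Real_Asymp.Real_Asymp"
begin

text \<open>
  Write \<open>\<alpha> = 1 - r\<close>, so that \<open>1/2 < \<alpha> \<le> 1\<close>, and \<open>W = max 1 \<phi> powr (1/\<alpha>)\<close>; the hypothesis says
  that \<open>W\<close> is integrable with respect to the law \<open>\<mu>\<close> of the observations. If \<open>\<phi>\<close> takes its minimum
  at \<open>s\<close>, then \<open>F\<^sub>n - F\<close> at \<open>x\<close> is, up to the sign, \<open>1/n\<close> times the centred number of hits of the ray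
  \<open>{x<..}\<close> (for \<open>x \<ge> s\<close>) or \<open>{..x}\<close> (for \<open>x \<le> s\<close>). With \<open>dev n B\<close> for the number of the first \<open>n\<close>
  observations in \<open>B\<close> minus its expectation, the claim becomes
  \<open>n powr (-\<alpha>) * W x powr \<alpha> * \<bar>dev n (A x)\<bar> \<longlonglongrightarrow> 0\<close> uniformly in \<open>x\<close>, for two families of nested rays
  \<open>A x\<close> whose points all have at least the weight \<open>W x\<close>. Lemma \<open>weighted_dev_le\<close> states this for one
  such family.

  Let \<open>g j = \<mu> {W \<ge> 2 ^ j}\<close>. Integrability of \<open>W\<close> amounts to the convergence of the sum of
  \<open>2 ^ j * g j\<close>. Sample sizes are taken in blocks \<open>2 ^ k \<le> n < 2 ^ (k + 1)\<close> and rays in levels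
  \<open>2 ^ j \<le> W x < 2 ^ (j + 1)\<close>, and \<open>i = k - j\<close>. A ray of level \<open>j\<close> has probability at most \<open>g j\<close>, hence
  \<open>O(2 ^ i)\<close> expected hits, whereas deviations up to \<open>\<delta> * 2 powr (\<alpha> * i)\<close> are harmless. This is a power
  of \<open>2 ^ i\<close> more than the standard deviation because \<open>\<alpha> > 1/2\<close>, so a single deviation of that size
  has probability \<open>O(2 ^ j * g j * 8 powr (-i))\<close> (lemma \<open>prob_abs_dev_dyadic_le\<close>). That the
  factor \<open>2 ^ j * g j\<close> survives is essential when \<open>i\<close> is bounded, since there the power of 8 gives
  nothing to sum over \<open>k\<close>.

  To pass from single rays and sample sizes to all of them, the monotonicity of hit counts both in
  the set and in the sample size is used: a grid of \<open>O(2 ^ i)\<close> sample sizes and \<open>O(2 ^ i)\<close>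
  probabilities per block and level brackets every count with an error of \<open>O(1)\<close> expected hits
  (lemma \<open>dev_le_if_no_grid_exceedance\<close>). The union bound costs \<open>4 ^ i\<close>, and the remaining bound
  \<open>O(2 ^ j * g j * 2 powr (-i))\<close> is summable over all \<open>k\<close> and \<open>j\<close>. By Borel-Cantelli, almost surely
  every deviation is eventually at most \<open>\<delta> * 2 powr (\<alpha> * i) + O(1)\<close>, which is small enough as soon
  as \<open>i\<close> exceeds a constant \<open>d\<close>. The rays with \<open>i < d\<close> eventually contain no observation
  (lemma \<open>eventually_no_heavy_sample\<close>), and their expected hits contribute \<open>O(2 ^ j * g j)\<close>, which
  tends to 0.
\<close>

section \<open>Elementary estimates for the exponential function\<close>

text \<open>The constant 1 in front of \<open>x\<^sup>2\<close> makes the exponential moments of a centred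
  Bernoulli sum at most \<open>exp (n p \<theta>\<^sup>2)\<close>, of the order of its variance.\<close>

lemma exp_le_quadratic:
  fixes x :: real
  assumes "\<bar>x\<bar> \<le> 1"
  shows "exp x \<le> 1 + x + x\<^sup>2"
proof (cases "x \<ge> 0")
  case True
  then show ?thesis using assms by (intro exp_bound) auto
next
  case False
  \<comment> \<open>For negative arguments the claim is \<open>1 \<le> (1 - y + y\<^sup>2) exp y\<close>, and the Taylor
    polynomial of degree 2 is a good enough minorant of \<open>exp y\<close>.\<close>
  define y where "y = - x"
  have y: "0 < y" "y \<le> 1" using False assms by (auto simp: y_def)
  have "1 + y + y\<^sup>2 / 2 \<le> exp y"
    using exp_lower_Taylor_quadratic[of y] y by simp
  moreover have "1 \<le> (1 - y + y\<^sup>2) * (1 + y + y\<^sup>2 / 2)"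
  proof -
    have "(1 - y + y\<^sup>2) * (1 + y + y\<^sup>2 / 2) = 1 + y\<^sup>2 / 2 + y ^ 3 / 2 + y ^ 4 / 2"
      by (simp add: power2_eq_square power3_eq_cube power4_eq_xxxx field_simps)
    moreover have "y\<^sup>2 \<ge> 0" "y ^ 3 \<ge> 0" "y ^ 4 \<ge> 0" using y by auto
    ultimately show ?thesis by linarith
  qed
  moreover have "0 \<le> 1 - y + y\<^sup>2" using y by auto
  ultimately have "1 \<le> (1 - y + y\<^sup>2) * exp y"
    by (meson mult_left_mono order_trans)
  then have "exp (- y) \<le> 1 - y + y\<^sup>2"
    by (simp add: exp_minus field_simps)
  then show ?thesis by (simp add: y_def)
qed

text \<open>The remainder \<open>exp s - 1 - s\<close> serves as a Markov test function. It vanishes to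
  second order at 0, so that its expectation is proportional to the variance, and it grows faster
  than every power.\<close>

lemma power_div_fact_le_exp_remainder:
  fixes u s :: real
  assumes "0 \<le> u" "u \<le> s" "2 \<le> m"
  shows "u ^ m / fact m \<le> exp s - 1 - s"
proof -
  have s: "0 \<le> s" using assms by simp
  \<comment> \<open>Of the exponential series only the terms 0, 1 and \<open>m\<close> are kept.\<close>
  have "(\<Sum>k\<in>{0, 1, m}. s ^ k /\<^sub>R fact k) \<le> (\<Sum>k. s ^ k /\<^sub>R fact k)"
    using s by (intro sum_le_suminf summable_exp_generic) auto
  moreover have "(\<Sum>k\<in>{0, 1, m}. s ^ k /\<^sub>R fact k) = 1 + s + s ^ m / fact m"
    using assms by (auto simp: field_simps)
  moreover have "u ^ m / fact m \<le> s ^ m / fact m"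
    using assms by (intro divide_right_mono power_mono) auto
  ultimately show ?thesis by (simp add: exp_def)
qed

lemma exp_minus_one_le:
  fixes y :: real
  assumes "0 \<le> y" "y \<le> 1"
  shows "exp y - 1 \<le> 2 * y"
proof -
  have "y\<^sup>2 \<le> y" using assms by (simp add: power2_eq_square mult_left_le)
  then show ?thesis using exp_le_quadratic[of y] assms by auto
qed

section \<open>Dyadic tail sums\<close>

lemma sum_dyadic_indicator_le:
  fixes w :: real
  assumes "0 \<le> w"
  shows "(\<Sum>j<n. 2 ^ j * indicator {y. 2 ^ j \<le> y} w) \<le> 2 * w"
proof (induction n)
  case 0
  then show ?case using assms by simp
next
  case (Suc n)
  show ?case
  proof (cases "2 ^ n \<le> w")
    case True
    have "(\<Sum>j<Suc n. 2 ^ j * indicator {y. 2 ^ j \<le> y} w) \<le> (\<Sum>j<Suc n. (2::real) ^ j)"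
      by (intro sum_mono) (auto simp: indicator_def)
    also have "\<dots> = 2 ^ Suc n - 1"
      by (simp add: geometric_sum)
    finally show ?thesis using True by simp
  next
    case False
    then show ?thesis using Suc by simp
  qed
qed

text \<open>The dyadic form of the layer-cake formula: pointwise, the sum of the powers of 2 not exceeding
  \<open>W x\<close> is less than \<open>2 * W x\<close>. This is the only way in which the moment hypothesis is used.\<close>

lemma (in finite_measure) summable_dyadic_tails:
  fixes W :: "'a \<Rightarrow> real"
  assumes [measurable]: "W \<in> borel_measurable M"
    and nonneg: "\<And>x. 0 \<le> W x" and fin: "(\<integral>\<^sup>+ x. ennreal (W x) \<partial>M) < \<infinity>"
  shows "summable (\<lambda>j. 2 ^ j * measure M {x \<in> space M. 2 ^ j \<le> W x})"
proof (rule summableI_nonneg_bounded)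
  have int: "integrable M W"
    using fin nonneg by (intro integrableI_nonneg) auto
  have int_ind: "integrable M (\<lambda>x. 2 ^ j * indicator {x \<in> space M. 2 ^ j \<le> W x} x :: real)" for j
    by (intro integrable_mult_right integrable_real_indicator) (auto simp: emeasure_eq_measure)
  fix n
  have "(\<Sum>j<n. 2 ^ j * measure M {x \<in> space M. 2 ^ j \<le> W x})
      = (\<Sum>j<n. (\<integral>x. 2 ^ j * indicator {x \<in> space M. 2 ^ j \<le> W x} x \<partial>M))"
    by (intro sum.cong refl) (simp add: Int_absorb1)
  also have "\<dots> = (\<integral>x. (\<Sum>j<n. 2 ^ j * indicator {x \<in> space M. 2 ^ j \<le> W x} x) \<partial>M)"
    by (intro Bochner_Integration.integral_sum[symmetric] int_ind)
  also have "\<dots> \<le> (\<integral>x. 2 * W x \<partial>M)"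
  proof (intro integral_mono)
    fix x assume "x \<in> space M"
    then have "(\<Sum>j<n. 2 ^ j * indicator {x \<in> space M. 2 ^ j \<le> W x} x)
        = (\<Sum>j<n. 2 ^ j * indicator {y. 2 ^ j \<le> y} (W x) :: real)"
      by (intro sum.cong) (auto simp: indicator_def)
    then show "(\<Sum>j<n. 2 ^ j * indicator {x \<in> space M. 2 ^ j \<le> W x} x) \<le> 2 * W x"
      using sum_dyadic_indicator_le[OF nonneg, where n = n, of x] by simp
  qed (intro Bochner_Integration.integrable_sum int_ind integrable_mult_right int)+
  finally show "(\<Sum>j<n. 2 ^ j * measure M {x \<in> space M. 2 ^ j \<le> W x}) \<le> (\<integral>x. 2 * W x \<partial>M)" .
qed auto

section \<open>Rays and their probabilities\<close>

text \<open>Inner regularity reduces a bound for a set to one for its compact subsets. A compact set of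
  reals contains its extreme points, hence lies in a closed ray whose end point belongs to the set;
  this turns an assumption on all rays with end point in \<open>B\<close> into a bound for \<open>B\<close>, whether or not
  the distribution has atoms.\<close>

lemma (in real_distribution) prob_le_of_compact_subsets:
  assumes "B \<in> sets borel" "0 \<le> c" "\<And>K. K \<subseteq> B \<Longrightarrow> compact K \<Longrightarrow> K \<noteq> {} \<Longrightarrow> prob K \<le> c"
  shows "prob B \<le> c"
proof -
  have "emeasure M B = (SUP K \<in> {K. K \<subseteq> B \<and> compact K}. emeasure M K)"
    using assms by (intro inner_regular) (auto simp: emeasure_eq_measure)
  also have "\<dots> \<le> ennreal c"
  proof (rule SUP_least, clarify)
    fix K assume "K \<subseteq> B" "compact K"
    then show "emeasure M K \<le> ennreal c"
      using assms by (cases "K = {}") (auto simp: emeasure_eq_measure intro!: ennreal_leI)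
  qed
  finally show ?thesis using assms by (simp add: emeasure_eq_measure)
qed

lemma (in real_distribution) ray_level_sets_borel:
  "{y. prob {y..} \<le> c} \<in> sets borel" "{y. prob {..y} \<le> c} \<in> sets borel"
  "{y. prob {y<..} < c} \<in> sets borel" "{y. prob {..<y} < c} \<in> sets borel"
  "{y. c \<le> prob {y<..}} \<in> sets borel" "{y. c \<le> prob {..<y}} \<in> sets borel"
proof -
  have "mono (\<lambda>y. - prob {y..})" "mono (\<lambda>y. - prob {y<..})"
    "mono (\<lambda>y. prob {..y})" "mono (\<lambda>y. prob {..<y})"
    by (auto intro!: monoI finite_measure_mono)
  note meas = this[THEN borel_measurable_mono]
  from meas(1,2)[THEN borel_measurable_uminus]
  have rays: "(\<lambda>y. prob {y..}) \<in> borel_measurable borel" "(\<lambda>y. prob {y<..}) \<in> borel_measurable borel"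
    by simp_all
  note le = borel_measurable_iff_le[THEN iffD1, rule_format]
    and less = borel_measurable_iff_less[THEN iffD1, rule_format]
    and ge = borel_measurable_iff_ge[THEN iffD1, rule_format]
  show "{y. prob {y..} \<le> c} \<in> sets borel" "{y. prob {..y} \<le> c} \<in> sets borel"
    "{y. prob {y<..} < c} \<in> sets borel" "{y. prob {..<y} < c} \<in> sets borel"
    "{y. c \<le> prob {y<..}} \<in> sets borel" "{y. c \<le> prob {..<y}} \<in> sets borel"
    using le[OF rays(1), of c] le[OF meas(3), of c] less[OF rays(2), of c] less[OF meas(4), of c]
      ge[OF rays(2), of c] ge[OF meas(4), of c]
    by simp_all
qed

text \<open>The next four lemmas are the two halves of the probability integral transform, for each
  direction of the line. Since the distribution may have atoms, only inequalities hold: the set of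
  points with small rays may be lighter, and the set defined by the open rays may be heavier, than
  the level \<open>c\<close>.\<close>

lemma (in real_distribution) prob_upper_ray_le:
  assumes "0 \<le> c"
  shows "prob {y. prob {y..} \<le> c} \<le> c"
proof (rule prob_le_of_compact_subsets)
  fix K assume K: "K \<subseteq> {y. prob {y..} \<le> c}" "compact K" "K \<noteq> {}"
  obtain k where k: "k \<in> K" "\<forall>y\<in>K. k \<le> y" using compact_attains_inf[OF K(2,3)] by blast
  then have "prob K \<le> prob {k..}" by (intro finite_measure_mono) auto
  then show "prob K \<le> c" using K k by auto
qed (use assms in \<open>auto intro: ray_level_sets_borel\<close>)

lemma (in real_distribution) prob_lower_ray_le:
  assumes "0 \<le> c"
  shows "prob {y. prob {..y} \<le> c} \<le> c"
proof (rule prob_le_of_compact_subsets)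
  fix K assume K: "K \<subseteq> {y. prob {..y} \<le> c}" "compact K" "K \<noteq> {}"
  obtain k where k: "k \<in> K" "\<forall>y\<in>K. y \<le> k" using compact_attains_sup[OF K(2,3)] by blast
  then have "prob K \<le> prob {..k}" by (intro finite_measure_mono) auto
  then show "prob K \<le> c" using K k by auto
qed (use assms in \<open>auto intro: ray_level_sets_borel\<close>)

lemma (in real_distribution) prob_upper_ray_less_ge:
  assumes "c \<le> 1"
  shows "c \<le> prob {y. prob {y<..} < c}"
proof -
  have "prob {y. c \<le> prob {y<..}} \<le> 1 - c"
  proof (rule prob_le_of_compact_subsets)
    fix K assume K: "K \<subseteq> {y. c \<le> prob {y<..}}" "compact K" "K \<noteq> {}"
    obtain k where k: "k \<in> K" "\<forall>y\<in>K. y \<le> k" using compact_attains_sup[OF K(2,3)] by blast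
    then have "prob K \<le> prob (space M - {k<..})" by (intro finite_measure_mono) auto
    also have "\<dots> = 1 - prob {k<..}" by (rule prob_compl) auto
    finally show "prob K \<le> 1 - c" using K k by auto
  qed (use assms in \<open>auto intro: ray_level_sets_borel\<close>)
  moreover have "{y. prob {y<..} < c} = space M - {y. c \<le> prob {y<..}}" by auto
  then have "prob {y. prob {y<..} < c} = 1 - prob {y. c \<le> prob {y<..}}"
    by (simp only: ) (rule prob_compl, simp add: ray_level_sets_borel)
  ultimately show ?thesis by simp
qed

lemma (in real_distribution) prob_lower_ray_less_ge:
  assumes "c \<le> 1"
  shows "c \<le> prob {y. prob {..<y} < c}"
proof -
  have "prob {y. c \<le> prob {..<y}} \<le> 1 - c"
  proof (rule prob_le_of_compact_subsets)
    fix K assume K: "K \<subseteq> {y. c \<le> prob {..<y}}" "compact K" "K \<noteq> {}"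
    obtain k where k: "k \<in> K" "\<forall>y\<in>K. k \<le> y" using compact_attains_inf[OF K(2,3)] by blast
    then have "prob K \<le> prob (space M - {..<k})" by (intro finite_measure_mono) auto
    also have "\<dots> = 1 - prob {..<k}" by (rule prob_compl) auto
    finally show "prob K \<le> 1 - c" using K k by auto
  qed (use assms in \<open>auto intro: ray_level_sets_borel\<close>)
  moreover have "{y. prob {..<y} < c} = space M - {y. c \<le> prob {..<y}}" by auto
  then have "prob {y. prob {..<y} < c} = 1 - prob {y. c \<le> prob {..<y}}"
    by (simp only: ) (rule prob_compl, simp add: ray_level_sets_borel)
  ultimately show ?thesis by simp
qed

section \<open>Deviations of hit counts in an i.i.d. sample\<close>

locale iid_sample = prob_space M for M :: "'a measure" +
  fixes X :: "nat \<Rightarrow> 'a \<Rightarrow> real" and \<mu> :: "real measure"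
  assumes indep: "indep_vars (\<lambda>_. borel) X {1..}"
    and distr_X: "\<And>i. 1 \<le> i \<Longrightarrow> distr M borel (X i) = \<mu>"
begin

lemma X_measurable: "1 \<le> i \<Longrightarrow> X i \<in> borel_measurable M"
  using indep by (auto simp: indep_vars_def)

sublocale law: real_distribution \<mu>
  using real_distribution_distr[OF X_measurable[of 1]] distr_X[of 1] by simp

definition dev :: "nat \<Rightarrow> real set \<Rightarrow> 'a \<Rightarrow> real" where
  "dev n B \<omega> = (\<Sum>i=1..n. indicator B (X i \<omega>)) - real n * law.prob B"

lemma prob_X_in:
  assumes "1 \<le> i" "B \<in> sets borel"
  shows "prob {\<omega> \<in> space M. X i \<omega> \<in> B} = law.prob B"
proof -
  have "law.prob B = prob (X i -` B \<inter> space M)"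
    using assms X_measurable by (subst distr_X[symmetric, OF assms(1)]) (rule measure_distr)
  also have "X i -` B \<inter> space M = {\<omega> \<in> space M. X i \<omega> \<in> B}" by auto
  finally show ?thesis by simp
qed

lemma X_in_event [measurable]:
  assumes "1 \<le> i" "B \<in> sets borel"
  shows "{\<omega> \<in> space M. X i \<omega> \<in> B} \<in> events"
  using measurable_sets[OF X_measurable[OF assms(1)] assms(2)]
  by (simp add: vimage_def Int_def conj_commute)

lemma indicator_X_measurable:
  assumes "1 \<le> i" "B \<in> sets borel"
  shows "(\<lambda>\<omega>. indicator B (X i \<omega>) :: real) \<in> borel_measurable M"
  by (rule measurable_compose[OF X_measurable[OF assms(1)]]) (use assms(2) in measurable)

lemma dev_measurable [measurable]:
  assumes "B \<in> sets borel"
  shows "dev n B \<in> borel_measurable M"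
  unfolding dev_def[abs_def] using assms
  by (intro borel_measurable_diff borel_measurable_sum indicator_X_measurable) auto

lemma integrable_indicator_X:
  assumes "1 \<le> i" "B \<in> sets borel"
  shows "integrable M (\<lambda>\<omega>. indicator B (X i \<omega>) :: real)"
  by (rule integrable_const_bound[where B = 1])
     (auto intro: indicator_X_measurable[OF assms] split: split_indicator)

lemma expectation_indicator_X:
  assumes "1 \<le> i" "B \<in> sets borel"
  shows "expectation (\<lambda>\<omega>. indicator B (X i \<omega>)) = law.prob B"
proof -
  have "expectation (\<lambda>\<omega>. indicator B (X i \<omega>)) = expectation (indicator {\<omega> \<in> space M. X i \<omega> \<in> B})"
    by (intro Bochner_Integration.integral_cong) (auto simp: indicator_def)
  also have "\<dots> = prob {\<omega> \<in> space M. X i \<omega> \<in> B}"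
    using X_in_event[OF assms] by (subst Bochner_Integration.integral_indicator) (auto simp: emeasure_eq_measure Int_absorb1)
  finally show ?thesis using prob_X_in[OF assms] by simp
qed

lemma integrable_dev: "B \<in> sets borel \<Longrightarrow> integrable M (dev n B)"
  unfolding dev_def[abs_def]
  by (intro Bochner_Integration.integrable_diff Bochner_Integration.integrable_sum
      integrable_indicator_X integrable_const) auto

lemma expectation_dev: "B \<in> sets borel \<Longrightarrow> expectation (dev n B) = 0"
  unfolding dev_def[abs_def]
  by (subst Bochner_Integration.integral_diff Bochner_Integration.integral_sum,
      auto intro!: integrable_indicator_X Bochner_Integration.integrable_sum
      simp: expectation_indicator_X prob_space simp del: One_nat_def)+

text \<open>Independence turns the exponential moment into a product of \<open>n\<close> factors, each at most
  \<open>exp (p (exp \<theta> - 1 - \<theta>))\<close> with \<open>p\<close> the probability of \<open>B\<close>.\<close>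

lemma exp_moment_dev:
  assumes B: "B \<in> sets borel" and \<theta>: "\<bar>\<theta>\<bar> \<le> 1"
  shows "integrable M (\<lambda>\<omega>. exp (\<theta> * dev n B \<omega>))" (is ?int)
    and "expectation (\<lambda>\<omega>. exp (\<theta> * dev n B \<omega>)) \<le> exp (real n * law.prob B * \<theta>\<^sup>2)" (is ?le)
proof -
  define \<beta> where "\<beta> = law.prob B"
  define Y where "Y i \<omega> = exp (\<theta> * (indicator B (X i \<omega>) - \<beta>))" for i \<omega>
  have Y_eq: "Y i \<omega> = exp (- \<theta> * \<beta>) * (1 + (exp \<theta> - 1) * indicator B (X i \<omega>))" for i \<omega>
    by (auto simp: Y_def indicator_def exp_diff exp_minus field_simps)
  have int_Y: "integrable M (Y i)" if "1 \<le> i" for i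
    unfolding Y_eq[abs_def] using that B
    by (intro integrable_mult_right Bochner_Integration.integrable_add integrable_indicator_X
        integrable_const)
  have E_Y: "expectation (Y i) \<le> exp (\<beta> * \<theta>\<^sup>2)" "0 \<le> expectation (Y i)" if i: "1 \<le> i" for i
  proof -
    have "expectation (Y i) = exp (- \<theta> * \<beta>) * (1 + (exp \<theta> - 1) * \<beta>)"
      unfolding Y_eq[abs_def] using i B
      by (simp add: integrable_indicator_X expectation_indicator_X \<beta>_def prob_space)
    also have "\<dots> \<le> exp (- \<theta> * \<beta>) * exp ((exp \<theta> - 1) * \<beta>)"
      by (intro mult_left_mono exp_ge_add_one_self) auto
    also have "\<dots> = exp (\<beta> * (exp \<theta> - 1 - \<theta>))"
      by (simp add: exp_add[symmetric] algebra_simps)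
    also have "\<dots> \<le> exp (\<beta> * \<theta>\<^sup>2)"
      using exp_le_quadratic[OF \<theta>] by (auto simp: \<beta>_def intro!: mult_left_mono)
    finally show "expectation (Y i) \<le> exp (\<beta> * \<theta>\<^sup>2)" .
    show "0 \<le> expectation (Y i)" by (intro Bochner_Integration.integral_nonneg) (auto simp: Y_def)
  qed
  have prod_Y: "exp (\<theta> * dev n B \<omega>) = (\<Prod>i\<in>{1..n}. Y i \<omega>)" for \<omega>
    by (simp add: Y_def exp_sum[symmetric] dev_def \<beta>_def sum_distrib_left sum_subtractf algebra_simps)
  have "indep_vars (\<lambda>_. borel) X {1..n}"
    by (rule indep_vars_subset[OF indep]) auto
  then have indep_Y: "indep_vars (\<lambda>_. borel) Y {1..n}"
    unfolding Y_def
    by (rule indep_vars_compose2[where Y = "\<lambda>_ y. exp (\<theta> * (indicator B y - \<beta>))"])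
       (use B in measurable)
  show ?int
    unfolding prod_Y by (intro indep_vars_integrable[OF _ indep_Y]) (auto intro: int_Y)
  have "expectation (\<lambda>\<omega>. exp (\<theta> * dev n B \<omega>)) = (\<Prod>i\<in>{1..n}. expectation (Y i))"
    unfolding prod_Y by (intro indep_vars_lebesgue_integral[OF _ indep_Y]) (auto intro: int_Y)
  also have "\<dots> \<le> (\<Prod>i\<in>{1..n}. exp (\<beta> * \<theta>\<^sup>2))"
    by (intro prod_mono) (auto intro: E_Y)
  also have "\<dots> = exp (real n * law.prob B * \<theta>\<^sup>2)"
    by (simp add: exp_of_nat_mult[symmetric] \<beta>_def mult_ac)
  finally show ?le .
qed

text \<open>Markov's inequality for \<open>exp s - 1 - s\<close> at \<open>s = \<theta> * dev n B \<omega>\<close>. The expectation of the linear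
  term is 0, so the bound keeps the factor \<open>n * b\<close>, which a Chernoff bound would lose. That factor
  is what makes the probabilities of rare events summable later.\<close>

lemma prob_dev_one_sided_le:
  assumes B: "B \<in> sets borel" and b: "law.prob B \<le> b"
    and \<theta>: "\<bar>\<theta>\<bar> \<le> 1" "real n * b * \<theta>\<^sup>2 \<le> 1" and u: "0 < u" and m: "2 \<le> m"
  shows "prob {\<omega> \<in> space M. u \<le> \<theta> * dev n B \<omega>} \<le> 2 * fact m * (real n * b * \<theta>\<^sup>2) / u ^ m"
proof -
  let ?f = "\<lambda>\<omega>. exp (\<theta> * dev n B \<omega>) - 1 - \<theta> * dev n B \<omega>"
  have int: "integrable M ?f"
    using exp_moment_dev(1)[OF B \<theta>(1)] integrable_dev[OF B] by auto
  have "prob {\<omega> \<in> space M. u \<le> \<theta> * dev n B \<omega>} \<le> prob {\<omega> \<in> space M. u ^ m / fact m \<le> ?f \<omega>}"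
    using u m B by (intro finite_measure_mono) (auto intro: power_div_fact_le_exp_remainder[rotated])
  also have "\<dots> \<le> expectation ?f / (u ^ m / fact m)"
  proof (rule integral_Markov_inequality_measure[OF int, where A = "{}"])
    show "AE \<omega> in M. 0 \<le> ?f \<omega>"
      by (auto simp: algebra_simps intro: exp_ge_add_one_self)
  qed (use u in auto)
  also have "expectation ?f = expectation (\<lambda>\<omega>. exp (\<theta> * dev n B \<omega>)) - 1"
    using exp_moment_dev(1)[OF B \<theta>(1)] integrable_dev[OF B] expectation_dev[OF B, of n]
    by (simp add: prob_space)
  also have "\<dots> \<le> exp (real n * b * \<theta>\<^sup>2) - 1"
  proof -
    have "exp (real n * law.prob B * \<theta>\<^sup>2) \<le> exp (real n * b * \<theta>\<^sup>2)"
      using b by (auto intro!: mult_right_mono mult_left_mono)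
    then show ?thesis using exp_moment_dev(2)[OF B \<theta>(1), of n] by linarith
  qed
  also have "\<dots> \<le> 2 * (real n * b * \<theta>\<^sup>2)"
    using \<theta> order_trans[OF measure_nonneg b] by (intro exp_minus_one_le) auto
  finally show ?thesis using u by (simp add: divide_right_mono field_simps)
qed

lemma prob_abs_dev_le:
  assumes B: "B \<in> sets borel" and b: "law.prob B \<le> b"
    and \<theta>: "0 < \<theta>" "\<theta> \<le> 1" "real n * b * \<theta>\<^sup>2 \<le> 1" and \<tau>: "0 < \<tau>" and m: "2 \<le> m"
  shows "prob {\<omega> \<in> space M. \<tau> \<le> \<bar>dev n B \<omega>\<bar>} \<le> 4 * fact m * (real n * b * \<theta>\<^sup>2) / (\<theta> * \<tau>) ^ m"
proof -
  let ?E = "\<lambda>s. {\<omega> \<in> space M. \<theta> * \<tau> \<le> s * dev n B \<omega>}"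
  have [measurable]: "dev n B \<in> borel_measurable M" using B by (rule dev_measurable)
  have "prob {\<omega> \<in> space M. \<tau> \<le> \<bar>dev n B \<omega>\<bar>} \<le> prob (?E \<theta> \<union> ?E (- \<theta>))"
  proof (intro finite_measure_mono subsetI)
    fix \<omega> assume "\<omega> \<in> {\<omega> \<in> space M. \<tau> \<le> \<bar>dev n B \<omega>\<bar>}"
    then have \<omega>: "\<omega> \<in> space M" "\<theta> * \<tau> \<le> \<theta> * \<bar>dev n B \<omega>\<bar>" using \<theta> by auto
    then show "\<omega> \<in> ?E \<theta> \<union> ?E (- \<theta>)" by (auto simp: abs_if split: if_splits)
  qed measurable
  also have "\<dots> \<le> prob (?E \<theta>) + prob (?E (- \<theta>))"
    by (intro measure_Un_le) measurable
  also have "\<dots> \<le> 2 * fact m * (real n * b * \<theta>\<^sup>2) / (\<theta> * \<tau>) ^ m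
      + 2 * fact m * (real n * b * (- \<theta>)\<^sup>2) / (\<theta> * \<tau>) ^ m"
    using \<theta> \<tau> m by (intro add_mono prob_dev_one_sided_le[OF B b]) auto
  also have "\<dots> = 4 * fact m * (real n * b * \<theta>\<^sup>2) / (\<theta> * \<tau>) ^ m"
    unfolding add_divide_distrib[symmetric] by simp
  finally show ?thesis .
qed

end

lemma ex_dyadic_level:
  fixes y :: real
  assumes "1 \<le> y"
  obtains j :: nat where "2 ^ j \<le> y" "y < 2 ^ (j + 1)"
proof -
  have fl: "1 \<le> nat \<lfloor>y\<rfloor>" "real (nat \<lfloor>y\<rfloor>) \<le> y" "y < real (nat \<lfloor>y\<rfloor>) + 1"
    using assms by linarith+
  obtain j where j: "2 ^ j \<le> nat \<lfloor>y\<rfloor>" "nat \<lfloor>y\<rfloor> < 2 ^ (j + 1)"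
    using ex_power_ivl1[of 2 "nat \<lfloor>y\<rfloor>"] fl(1) by auto
  have "2 ^ j \<le> real (nat \<lfloor>y\<rfloor>)"
    using j(1) by (metis of_nat_le_iff of_nat_numeral of_nat_power)
  moreover have "real (nat \<lfloor>y\<rfloor>) + 1 \<le> 2 ^ (j + 1)"
    using j(2) by (metis Suc_leI add.commute of_nat_Suc of_nat_le_iff of_nat_numeral of_nat_power)
  ultimately show ?thesis using fl by (intro that[of j]) linarith+
qed

lemma (in iid_sample) dev_le_mono:
  assumes "B \<subseteq> B'" "n \<le> n'"
  shows "dev n B \<omega> \<le> dev n' B' \<omega> + (real n' * law.prob B' - real n * law.prob B)"
proof -
  have "(\<Sum>i=1..n. indicat_real B (X i \<omega>)) \<le> (\<Sum>i=1..n. indicat_real B' (X i \<omega>))"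
    using assms by (intro sum_mono) (auto simp: indicator_def)
  also have "\<dots> \<le> (\<Sum>i=1..n'. indicat_real B' (X i \<omega>))"
    using assms by (intro sum_mono2) auto
  finally show ?thesis by (simp add: dev_def)
qed

section \<open>Uniform deviations along a weighted chain of rays\<close>

text \<open>Both tails of the line are treated at once. A family of rays \<open>A x\<close> carries the weights \<open>W x\<close>,
  and every point of \<open>A x\<close> has at least the weight of \<open>x\<close>; so heavily weighted rays are rare. The
  sets \<open>L c\<close> and \<open>U c\<close> bracket the rays by their probability: \<open>L c\<close> contains all rays of
  probability at most \<open>c\<close> without exceeding that probability, and \<open>U c\<close> is contained in all rays
  of probability at least \<open>c\<close> without falling below it.\<close>

locale weighted_chain = iid_sample M X \<mu>
  for M :: "'a measure" and X :: "nat \<Rightarrow> 'a \<Rightarrow> real" and \<mu> :: "real measure" +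
  fixes W :: "real \<Rightarrow> real" and T :: "real set" and A :: "real \<Rightarrow> real set"
    and L U :: "real \<Rightarrow> real set"
  assumes W_meas [measurable]: "W \<in> borel_measurable borel"
    and W_ge_1: "\<And>y. 1 \<le> W y"
    and W_int: "(\<integral>\<^sup>+ y. ennreal (W y) \<partial>\<mu>) < \<infinity>"
    and A_W: "\<And>x y. x \<in> T \<Longrightarrow> y \<in> A x \<Longrightarrow> W x \<le> W y"
    and L_meas: "\<And>c. L c \<in> sets borel" and U_meas: "\<And>c. U c \<in> sets borel"
    and prob_L: "\<And>c. 0 \<le> c \<Longrightarrow> measure \<mu> (L c) \<le> c"
    and prob_U: "\<And>c. c \<le> 1 \<Longrightarrow> c \<le> measure \<mu> (U c)"
    and A_subset_L: "\<And>x c. x \<in> T \<Longrightarrow> measure \<mu> (A x) \<le> c \<Longrightarrow> A x \<subseteq> L c"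
    and U_subset_A: "\<And>x c. x \<in> T \<Longrightarrow> c \<le> measure \<mu> (A x) \<Longrightarrow> U c \<subseteq> A x"
begin

definition heavy :: "nat \<Rightarrow> real set" where
  "heavy j = {y. 2 ^ j \<le> W y}"

text \<open>In the block of sample sizes between \<open>2 ^ k\<close> and \<open>2 ^ (k + 1)\<close> and for the weights of dyadic
  level \<open>j\<close>, put \<open>i = k - j\<close>. A ray has at most of the order of \<open>2 ^ i\<close> expected hits, and
  \<open>\<delta> * 2 powr (\<alpha> * i)\<close> is the deviation that can be tolerated. The sample sizes advance in steps of
  \<open>2 ^ j\<close> and the probabilities in steps of \<open>1 / 2 ^ k\<close>; either step changes the expected number
  of hits by a bounded amount, and \<open>O(2 ^ i)\<close> steps of each kind suffice. Intersecting the
  brackets with \<open>heavy j\<close> makes all of them as rare as the rays that they bracket.\<close>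

definition grid_exceedance :: "real \<Rightarrow> real \<Rightarrow> nat \<Rightarrow> nat \<Rightarrow> nat \<Rightarrow> 'a set" where
  "grid_exceedance \<alpha> \<delta> C k j =
     (\<Union>(a, b, S) \<in> {..2 ^ (k - j)} \<times> {..C * 2 ^ (k - j) + 1} \<times> {L, U}.
        {\<omega> \<in> space M. \<delta> * 2 powr (\<alpha> * real (k - j))
           \<le> \<bar>dev (2 ^ k + a * 2 ^ j) (S (real b / 2 ^ k) \<inter> heavy j) \<omega>\<bar>})"

lemma heavy_meas [measurable]: "heavy j \<in> sets borel"
  unfolding heavy_def by measurable

lemma heavy_antimono: "i \<le> j \<Longrightarrow> heavy j \<subseteq> heavy i"
  unfolding heavy_def by (auto intro: order_trans[OF power_increasing])

lemma A_subset_heavy: "x \<in> T \<Longrightarrow> 2 ^ j \<le> W x \<Longrightarrow> A x \<subseteq> heavy j"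
  unfolding heavy_def using A_W by force

lemma summable_heavy: "summable (\<lambda>j. 2 ^ j * law.prob (heavy j))"
  using law.summable_dyadic_tails[of W] W_ge_1 W_int
  by (simp add: heavy_def order_trans[OF zero_le_one])

lemma heavy_bounded: "\<exists>C\<ge>1. \<forall>j. 2 ^ j * law.prob (heavy j) \<le> real C"
proof -
  let ?C = "Suc (nat \<lceil>\<Sum>j. 2 ^ j * law.prob (heavy j)\<rceil>)"
  have "2 ^ j * law.prob (heavy j) \<le> (\<Sum>j. 2 ^ j * law.prob (heavy j))" for j
    using sum_le_suminf[OF summable_heavy, of "{j}"] by simp
  then have "2 ^ j * law.prob (heavy j) \<le> real ?C" for j
    by (rule order_trans) linarith
  then show ?thesis by (intro exI[of _ ?C]) auto
qed

lemma grid_meas: "S \<in> {L, U} \<Longrightarrow> S c \<inter> heavy j \<in> sets borel"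
  using L_meas U_meas by auto

lemma grid_exceedance_events: "grid_exceedance \<alpha> \<delta> C k j \<in> events"
  unfolding grid_exceedance_def
proof (intro sets.finite_UN, goal_cases)
  case (2 p)
  obtain a b S where p: "p = (a, b, S)" by (cases p)
  have [measurable]: "dev n (S c \<inter> heavy j) \<in> borel_measurable M" for n c
    using 2 by (intro dev_measurable grid_meas) (auto simp: p)
  show ?case unfolding p by simp
qed auto

text \<open>With \<open>i = k - j\<close>, the denominator \<open>8 ^ i\<close> outweighs the \<open>O(4 ^ i)\<close> grid points and leaves a
  geometric series. It is available because the threshold \<open>2 powr (\<alpha> * i)\<close> is larger than the
  standard deviation, at most of order \<open>2 powr (i / 2)\<close>, by a power of \<open>2 ^ i\<close>: here \<open>\<alpha> > 1 / 2\<close> enters.\<close>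

lemma prob_abs_dev_dyadic_le:
  assumes \<alpha>: "1 / 2 < \<alpha>" and \<delta>: "0 < \<delta>" and C: "1 \<le> C" "\<And>j. 2 ^ j * law.prob (heavy j) \<le> real C"
  shows "\<exists>K\<ge>0. \<forall>k j n B. j \<le> k \<longrightarrow> n \<le> 2 ^ (k + 1) \<longrightarrow> B \<in> sets borel \<longrightarrow> B \<subseteq> heavy j \<longrightarrow>
    prob {\<omega> \<in> space M. \<delta> * 2 powr (\<alpha> * real (k - j)) \<le> \<bar>dev n B \<omega>\<bar>}
      \<le> K * (2 ^ j * law.prob (heavy j)) / 8 ^ (k - j)"
proof -
  define \<rho> where "\<rho> = \<delta> / sqrt (2 * C)"
  \<comment> \<open>The tail bound of order \<open>m\<close> gains the factor \<open>2 powr (- m (\<alpha> - 1/2) i)\<close>, which has to beat \<open>8 ^ i\<close>.\<close>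
  obtain m' :: nat where m': "3 / (\<alpha> - 1 / 2) \<le> real m'" using real_arch_simple by blast
  define m where "m = m' + 2"
  have m: "2 \<le> m" "3 \<le> real m * (\<alpha> - 1 / 2)"
    using m' \<alpha> by (auto simp: m_def field_simps)
  have \<rho>: "0 < \<rho>" using \<delta> C by (simp add: \<rho>_def)
  define K where "K = 4 * fact m / \<rho> ^ m"
  have "prob {\<omega> \<in> space M. \<delta> * 2 powr (\<alpha> * real (k - j)) \<le> \<bar>dev n B \<omega>\<bar>}
      \<le> K * (2 ^ j * law.prob (heavy j)) / 8 ^ (k - j)"
    if jk: "j \<le> k" and n: "n \<le> 2 ^ (k + 1)" and B: "B \<in> sets borel" "B \<subseteq> heavy j" for k j n B
  proof -
    define i where "i = k - j"
    define g where "g = law.prob (heavy j)"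
    \<comment> \<open>The scale is the inverse of a bound for the standard deviation, so that the exponent \<open>n g \<theta>\<^sup>2\<close> is at most 1.\<close>
    define \<theta> where "\<theta> = 1 / sqrt (2 * C * 2 ^ i)"
    have k: "k = j + i" using jk by (simp add: i_def)
    have C1: "1 \<le> real C" using C by simp
    have "1 \<le> 2 * real C * 2 ^ i" using C1 mult_mono[of 1 "2 * real C" 1 "2 ^ i"] by simp
    then have \<theta>: "0 < \<theta>" "\<theta> \<le> 1" "\<theta>\<^sup>2 = 1 / (2 * C * 2 ^ i)"
      by (auto simp: \<theta>_def power_divide)
    have g: "0 \<le> g" "2 ^ j * g \<le> real C" using C by (auto simp: g_def)
    have le_g: "law.prob B \<le> g"
      using B by (auto simp: g_def intro!: law.finite_measure_mono)
    have ngt: "real n * g * \<theta>\<^sup>2 \<le> 2 ^ j * g / real C"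
    proof -
      have "real n \<le> 2 ^ (k + 1)" using n by (metis of_nat_le_iff of_nat_numeral of_nat_power)
      then have "real n * g * \<theta>\<^sup>2 \<le> 2 ^ (k + 1) * g * \<theta>\<^sup>2"
        using g by (intro mult_right_mono) auto
      also have "\<dots> = 2 ^ j * g / real C"
        using C1 by (simp add: \<theta>(3) k power_add field_simps)
      finally show ?thesis .
    qed
    have "2 ^ j * g / real C \<le> 1" using g C1 by (simp add: field_simps)
    then have small: "real n * g * \<theta>\<^sup>2 \<le> 1" using ngt by linarith
    have "2 ^ j * g / real C \<le> 2 ^ j * g" using g C1 divide_left_mono[of 1 "real C" "2 ^ j * g"] by simp
    then have ngt': "real n * g * \<theta>\<^sup>2 \<le> 2 ^ j * g" using ngt by linarith
    have \<theta>\<tau>: "\<theta> * (\<delta> * 2 powr (\<alpha> * real i)) = \<rho> * 2 powr ((\<alpha> - 1 / 2) * real i)"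
    proof -
      have "sqrt (2 ^ i) = 2 powr (real i / 2)"
        by (simp add: powr_half_sqrt[symmetric] powr_realpow[symmetric] powr_powr)
      then have "\<theta> * 2 powr (\<alpha> * real i) = 2 powr (\<alpha> * real i - real i / 2) / sqrt (2 * C)"
        by (simp add: \<theta>_def real_sqrt_mult powr_diff)
      also have "\<alpha> * real i - real i / 2 = (\<alpha> - 1 / 2) * real i" by (simp add: algebra_simps)
      finally have "\<delta> * (\<theta> * 2 powr (\<alpha> * real i)) = \<rho> * 2 powr ((\<alpha> - 1 / 2) * real i)"
        by (simp add: \<rho>_def)
      then show ?thesis by (simp only: mult.left_commute)
    qed
    have "(8::real) ^ i = 2 powr (3 * real i)"
      by (simp add: powr_powr[symmetric] powr_realpow)
    also have "\<dots> \<le> 2 powr (real m * (\<alpha> - 1 / 2) * real i)"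
      using m by (intro powr_mono mult_right_mono) auto
    also have "\<dots> = (2 powr ((\<alpha> - 1 / 2) * real i)) ^ m"
      by (simp add: powr_powr powr_realpow[symmetric] mult_ac)
    finally have "\<rho> ^ m * 8 ^ i \<le> (\<theta> * (\<delta> * 2 powr (\<alpha> * real i))) ^ m"
      unfolding \<theta>\<tau> power_mult_distrib using \<rho> by (intro mult_left_mono) auto
    then have "4 * fact m * (real n * g * \<theta>\<^sup>2) / (\<theta> * (\<delta> * 2 powr (\<alpha> * real i))) ^ m
        \<le> 4 * fact m * (2 ^ j * g) / (\<rho> ^ m * 8 ^ i)"
      using \<rho> g ngt' by (intro frac_le mult_left_mono) auto
    moreover have "prob {\<omega> \<in> space M. \<delta> * 2 powr (\<alpha> * real i) \<le> \<bar>dev n B \<omega>\<bar>}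
        \<le> 4 * fact m * (real n * g * \<theta>\<^sup>2) / (\<theta> * (\<delta> * 2 powr (\<alpha> * real i))) ^ m"
      using B le_g \<theta> small \<delta> m by (intro prob_abs_dev_le) auto
    ultimately show ?thesis by (simp add: K_def g_def i_def)
  qed
  moreover have "0 \<le> K" using \<rho> by (simp add: K_def)
  ultimately show ?thesis by blast
qed

lemma prob_grid_exceedance_le:
  assumes \<alpha>: "1 / 2 < \<alpha>" and \<delta>: "0 < \<delta>" and C: "1 \<le> C" "\<And>j. 2 ^ j * law.prob (heavy j) \<le> real C"
  shows "\<exists>K\<ge>0. \<forall>k. \<forall>j\<le>k. prob (grid_exceedance \<alpha> \<delta> C k j) \<le> K * (2 ^ j * law.prob (heavy j)) * (1 / 2) ^ (k - j)"
proof -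
  obtain K where K: "K \<ge> 0" "\<And>k j n B. j \<le> k \<Longrightarrow> n \<le> 2 ^ (k + 1) \<Longrightarrow> B \<in> sets borel \<Longrightarrow> B \<subseteq> heavy j \<Longrightarrow>
    prob {\<omega> \<in> space M. \<delta> * 2 powr (\<alpha> * real (k - j)) \<le> \<bar>dev n B \<omega>\<bar>}
      \<le> K * (2 ^ j * law.prob (heavy j)) / 8 ^ (k - j)"
    using prob_abs_dev_dyadic_le[OF assms] by blast
  have "prob (grid_exceedance \<alpha> \<delta> C k j) \<le> (12 * C * K) * (2 ^ j * law.prob (heavy j)) * (1 / 2) ^ (k - j)"
    if jk: "j \<le> k" for k j
  proof -
    define i where "i = k - j"
    define p where "p = K * (2 ^ j * law.prob (heavy j)) / 8 ^ i"
    define I where "I = {..(2::nat) ^ i} \<times> {..C * 2 ^ i + 1} \<times> {L, U}"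
    let ?E = "\<lambda>(a, b, S). {\<omega> \<in> space M. \<delta> * 2 powr (\<alpha> * real i)
           \<le> \<bar>dev (2 ^ k + a * 2 ^ j) (S (real b / 2 ^ k) \<inter> heavy j) \<omega>\<bar>}"
    have k: "k = j + i" using jk by (simp add: i_def)
    have p0: "0 \<le> p" using K by (simp add: p_def)
    have meas: "?E q \<in> events" if "q \<in> I" for q
    proof -
      obtain a b S where q: "q = (a, b, S)" by (cases q)
      have [measurable]: "dev n (S c \<inter> heavy j) \<in> borel_measurable M" for n c
        using that by (intro dev_measurable grid_meas) (auto simp: q I_def)
      show ?thesis unfolding q by simp
    qed
    have le_p: "prob (?E q) \<le> p" if q: "q \<in> I" for q
    proof -
      obtain a b S where q': "q = (a, b, S)" by (cases q)
      have "a * 2 ^ j \<le> 2 ^ i * 2 ^ j" using q by (auto simp: q' I_def)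
      then have "2 ^ k + a * 2 ^ j \<le> 2 ^ (k + 1)" by (simp add: k power_add mult_ac)
      moreover have "S c \<inter> heavy j \<in> sets borel" for c
        using q by (intro grid_meas) (auto simp: q' I_def)
      ultimately show ?thesis
        using K(2)[OF jk] unfolding q' p_def i_def by simp
    qed
    have "prob (grid_exceedance \<alpha> \<delta> C k j) \<le> (\<Sum>q\<in>I. prob (?E q))"
      unfolding grid_exceedance_def i_def[symmetric] I_def[symmetric]
      using meas by (intro measure_UNION_le) (auto simp: I_def)
    also have "\<dots> \<le> real (card I) * p"
      using le_p by (rule sum_bounded_above)
    also have "\<dots> \<le> (12 * C * 4 ^ i) * p"
    proof (intro mult_right_mono p0)
      have "card I = (2 ^ i + 1) * ((C * 2 ^ i + 2) * card {L, U})"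
        by (simp add: I_def card_cartesian_product)
      also have "\<dots> \<le> (2 * 2 ^ i) * ((3 * C * 2 ^ i) * 2)"
      proof (intro mult_mono)
        have "1 * 1 \<le> C * 2 ^ i" using C by (intro mult_mono) auto
        then show "C * 2 ^ i + 2 \<le> 3 * C * 2 ^ i" by simp
        show "card {L, U} \<le> 2" by (simp add: card_insert_if)
      qed auto
      also have "\<dots> = 12 * C * 4 ^ i"
        by (simp add: power_mult_distrib[symmetric] mult_ac)
      finally show "real (card I) \<le> 12 * C * 4 ^ i"
        by (metis (mono_tags) of_nat_le_iff of_nat_mult of_nat_numeral of_nat_power)
    qed
    also have "\<dots> = (12 * C * K) * (2 ^ j * law.prob (heavy j)) * (4 ^ i / 8 ^ i)"
      by (simp add: p_def)
    also have "(4::real) ^ i / 8 ^ i = (1 / 2) ^ i"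
      by (simp add: power_divide[symmetric])
    finally show ?thesis by (simp add: i_def)
  qed
  then show ?thesis using K(1) by (intro exI[of _ "12 * C * K"]) auto
qed

text \<open>With \<open>i = k - j\<close>, the union bound for a block is a Cauchy product of the summable dyadic tails
  with a geometric series in \<open>i\<close>, so Borel-Cantelli applies.\<close>

lemma eventually_no_grid_exceedance:
  assumes \<alpha>: "1 / 2 < \<alpha>" and \<delta>: "0 < \<delta>" and C: "1 \<le> C" "\<And>j. 2 ^ j * law.prob (heavy j) \<le> real C"
  shows "AE \<omega> in M. \<forall>\<^sub>F k in sequentially. \<forall>j\<le>k. \<omega> \<notin> grid_exceedance \<alpha> \<delta> C k j"
proof -
  obtain K where K: "K \<ge> 0"
    "\<And>k j. j \<le> k \<Longrightarrow> prob (grid_exceedance \<alpha> \<delta> C k j) \<le> K * (2 ^ j * law.prob (heavy j)) * (1 / 2) ^ (k - j)"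
    using prob_grid_exceedance_le[OF assms] by blast
  define E where "E k = (\<Union>j\<in>{..k}. grid_exceedance \<alpha> \<delta> C k j)" for k
  have [measurable]: "E k \<in> events" for k
    unfolding E_def by (intro sets.finite_UN grid_exceedance_events) auto
  have le: "prob (E k) \<le> (\<Sum>j\<le>k. K * (2 ^ j * law.prob (heavy j)) * (1 / 2) ^ (k - j))" for k
  proof -
    have "prob (E k) \<le> (\<Sum>j\<le>k. prob (grid_exceedance \<alpha> \<delta> C k j))"
      unfolding E_def by (intro measure_UNION_le grid_exceedance_events) auto
    also have "\<dots> \<le> (\<Sum>j\<le>k. K * (2 ^ j * law.prob (heavy j)) * (1 / 2) ^ (k - j))"
      by (intro sum_mono K(2)) auto
    finally show ?thesis .
  qed
  have "summable (\<lambda>k. \<Sum>j\<le>k. (K * (2 ^ j * law.prob (heavy j))) * (1 / 2) ^ (k - j))"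
  proof (rule summable_Cauchy_product)
    have "norm (K * (2 ^ j * law.prob (heavy j))) = K * (2 ^ j * law.prob (heavy j))" for j
      using K(1) by (simp add: abs_mult)
    then show "summable (\<lambda>j. norm (K * (2 ^ j * law.prob (heavy j))))"
      using summable_mult[OF summable_heavy, of K] by simp
    show "summable (\<lambda>i. norm ((1 / 2 :: real) ^ i))" by (simp add: summable_geometric)
  qed
  then have "summable (\<lambda>k. prob (E k))"
    by (rule summable_comparison_test'[where N = 0]) (simp add: le)
  then have "AE \<omega> in M. \<forall>\<^sub>F k in sequentially. \<omega> \<in> space M - E k"
    by (intro borel_cantelli_AE1) (auto simp: emeasure_eq_measure)
  then show ?thesis
    by eventually_elim (auto simp: E_def elim: eventually_mono)
qed

text \<open>Each of the \<open>2 ^ (k + 1)\<close> observations is heavy with the probability of \<open>heavy (k - d)\<close>; up to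
  the factor \<open>2 ^ (d + 1)\<close> the union bound is again a term of the summable dyadic tails.\<close>

lemma eventually_no_heavy_sample:
  "AE \<omega> in M. \<forall>\<^sub>F k in sequentially. \<forall>i. 1 \<le> i \<longrightarrow> i \<le> 2 ^ (k + 1) \<longrightarrow> X i \<omega> \<notin> heavy (k - d)"
proof -
  define E where "E k = (\<Union>i\<in>{1..2 ^ (k + 1)}. {\<omega> \<in> space M. X i \<omega> \<in> heavy (k - d)})" for k
  have [measurable]: "E k \<in> events" for k
    unfolding E_def by (intro sets.finite_UN X_in_event) auto
  have le: "prob (E k) \<le> 2 ^ (k + 1) * law.prob (heavy (k - d))" for k
  proof -
    have "prob (E k) \<le> (\<Sum>i\<in>{1..2 ^ (k + 1)}. prob {\<omega> \<in> space M. X i \<omega> \<in> heavy (k - d)})"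
      unfolding E_def by (intro measure_UNION_le X_in_event) auto
    also have "\<dots> = (\<Sum>i\<in>{1..2 ^ (k + 1)::nat}. law.prob (heavy (k - d)))"
      by (intro sum.cong prob_X_in) auto
    finally show ?thesis by simp
  qed
  have "summable (\<lambda>k. 2 ^ (d + 1) * (2 ^ k * law.prob (heavy k)))"
    by (intro summable_mult summable_heavy)
  then have "summable (\<lambda>k. prob (E (k + d)))"
  proof (rule summable_comparison_test'[where N = 0])
    show "norm (prob (E (k + d))) \<le> 2 ^ (d + 1) * (2 ^ k * law.prob (heavy k))" for k
      using le[of "k + d"] by (simp add: power_add mult_ac)
  qed
  then have "summable (\<lambda>k. prob (E k))" by (rule summable_iff_shift[THEN iffD1])
  then have "AE \<omega> in M. \<forall>\<^sub>F k in sequentially. \<omega> \<in> space M - E k"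
    by (intro borel_cantelli_AE1) (auto simp: emeasure_eq_measure)
  then show ?thesis
    by eventually_elim (auto simp: E_def elim!: eventually_mono)
qed

text \<open>Hit counts increase with the sample size and with the set. Hence the count of a ray lies
  between the count of an inner bracket at the previous grid time and that of an outer bracket at
  the next one, and the expected counts of these two differ by at most a constant from that of the
  ray.\<close>

lemma dev_le_if_no_grid_exceedance:
  assumes \<omega>: "\<omega> \<in> space M" "\<omega> \<notin> grid_exceedance \<alpha> \<delta> C k j" and jk: "j \<le> k"
    and C: "2 ^ j * law.prob (heavy j) \<le> real C"
    and x: "x \<in> T" "2 ^ j \<le> W x"
    and n: "2 ^ k \<le> n" "n < 2 ^ (k + 1)"
  shows "\<bar>dev n (A x) \<omega>\<bar> \<le> \<delta> * 2 powr (\<alpha> * real (k - j)) + (real C + 2)"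
proof -
  define i where "i = k - j"
  define \<tau> where "\<tau> = \<delta> * 2 powr (\<alpha> * real i)"
  define \<beta> where "\<beta> = law.prob (A x)"
  \<comment> \<open>Grid cell of \<open>n\<close> (between \<open>n0\<close> and \<open>n1\<close>) and of \<open>\<beta>\<close> (between \<open>b / 2 ^ k\<close> and \<open>(b + 1) / 2 ^ k\<close>).\<close>
  define a where "a = (n - 2 ^ k) div 2 ^ j"
  define b where "b = nat \<lfloor>\<beta> * 2 ^ k\<rfloor>"
  define n0 where "n0 = 2 ^ k + a * 2 ^ j"
  define n1 where "n1 = 2 ^ k + (a + 1) * 2 ^ j"
  have k: "k = i + j" using jk by (simp add: i_def)
  have grid: "\<bar>dev (2 ^ k + a' * 2 ^ j) (S (real b' / 2 ^ k) \<inter> heavy j) \<omega>\<bar> \<le> \<tau>"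
    if "a' \<le> 2 ^ i" "b' \<le> C * 2 ^ i + 1" "S \<in> {L, U}" for a' b' S
    using \<omega> that unfolding grid_exceedance_def i_def \<tau>_def by fastforce
  have a: "a < 2 ^ i"
  proof -
    have "n - 2 ^ k < 2 ^ i * 2 ^ j" using n by (simp add: k power_add)
    then show ?thesis unfolding a_def by (simp add: less_mult_imp_div_less)
  qed
  have "a * 2 ^ j \<le> n - 2 ^ k" "n - 2 ^ k < (a + 1) * 2 ^ j"
    unfolding a_def using dividend_less_div_times[of "2 ^ j" "n - 2 ^ k"] by (auto simp: algebra_simps)
  then have n01: "n0 \<le> n" "n \<le> n1" "n1 = n0 + 2 ^ j"
    using n by (auto simp: n0_def n1_def)
  have "(a + 1) * 2 ^ j \<le> 2 ^ i * 2 ^ j" using a by (intro mult_right_mono) auto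
  then have "n1 \<le> 2 ^ (k + 1)" by (simp add: n1_def k power_add)
  then have n1_le: "real n1 \<le> 2 * 2 ^ k"
    by (metis of_nat_le_iff of_nat_numeral of_nat_power power_Suc Suc_eq_plus1)
  have AV: "A x \<subseteq> heavy j" using A_subset_heavy x by blast
  have \<beta>: "0 \<le> \<beta>" "\<beta> \<le> 1" "2 ^ j * \<beta> \<le> real C"
  proof -
    have "\<beta> \<le> law.prob (heavy j)" unfolding \<beta>_def by (rule law.finite_measure_mono[OF AV]) auto
    then have "2 ^ j * \<beta> \<le> 2 ^ j * law.prob (heavy j)" by (intro mult_left_mono) auto
    then show "2 ^ j * \<beta> \<le> real C" using C by linarith
  qed (auto simp: \<beta>_def)
  have b: "real b \<le> \<beta> * 2 ^ k" "\<beta> * 2 ^ k \<le> real b + 1"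
    using \<beta>(1) by (auto simp: b_def) (linarith+)?
  have b_le: "b \<le> C * 2 ^ i"
  proof -
    have "\<beta> * 2 ^ k = 2 ^ j * \<beta> * 2 ^ i" by (simp add: k power_add)
    also have "\<dots> \<le> real C * 2 ^ i" using \<beta>(3) by (intro mult_right_mono) auto
    finally have "real b \<le> real (C * 2 ^ i)" using b by simp
    then show ?thesis by (simp only: of_nat_le_iff)
  qed
  have c: "real b / 2 ^ k \<le> \<beta>" "\<beta> \<le> real (b + 1) / 2 ^ k" using b by (auto simp: field_simps)
  have step_n: "(real n1 - real n0) * \<beta> \<le> real C" using \<beta> n01 by simp
  have "real n0 \<le> real n1" using n01 by simp
  then have step_c: "real n1 / 2 ^ k \<le> 2" "real n0 / 2 ^ k \<le> 2"
    using n1_le by (simp_all add: divide_le_eq)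
  have mean: "real n0 * \<beta> \<le> real n * \<beta>" "real n * \<beta> \<le> real n1 * \<beta>"
    using \<beta>(1) n01(1,2) by (simp_all add: mult_right_mono)
  have upper: "dev n (A x) \<omega> \<le> \<tau> + (real C + 2)"
  proof -
    let ?B = "L (real (b + 1) / 2 ^ k) \<inter> heavy j"
    have sub: "A x \<subseteq> ?B" using A_subset_L[OF x(1), folded \<beta>_def, OF c(2)] AV by auto
    \<comment> \<open>Moving to the outer bracket costs 2 (probability step) and \<open>C\<close> (time step) expected hits.\<close>
    have "law.prob ?B \<le> law.prob (L (real (b + 1) / 2 ^ k))"
      using L_meas by (intro law.finite_measure_mono) auto
    also have "\<dots> \<le> real (b + 1) / 2 ^ k" by (intro prob_L) auto
    also have "\<dots> \<le> \<beta> + 1 / 2 ^ k" using c(1) by (simp add: add_divide_distrib)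
    finally have "real n1 * law.prob ?B \<le> real n1 * (\<beta> + 1 / 2 ^ k)"
      by (rule mult_left_mono) simp
    also have "\<dots> = real n1 * \<beta> + real n1 / 2 ^ k" by (simp add: distrib_left)
    finally have "real n1 * law.prob ?B \<le> real n1 * \<beta> + real n1 / 2 ^ k" .
    moreover have "dev n (A x) \<omega> \<le> dev n1 ?B \<omega> + (real n1 * law.prob ?B - real n * \<beta>)"
      unfolding \<beta>_def using n01 by (intro dev_le_mono sub)
    moreover have "dev n1 ?B \<omega> \<le> \<tau>"
      using grid[of "a + 1" "b + 1" L] a b_le by (auto simp: n1_def)
    ultimately show ?thesis using step_n step_c mean by (simp add: algebra_simps)
  qed
  have lower: "- (\<tau> + (real C + 2)) \<le> dev n (A x) \<omega>"
  proof -
    let ?B = "U (real b / 2 ^ k) \<inter> heavy j"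
    have UA: "U (real b / 2 ^ k) \<subseteq> A x" using U_subset_A[OF x(1), folded \<beta>_def, OF c(1)] .
    then have B: "?B = U (real b / 2 ^ k)" using AV by auto
    have "\<beta> - 1 / 2 ^ k \<le> real b / 2 ^ k" using c(2) by (simp add: add_divide_distrib)
    also have "\<dots> \<le> law.prob ?B" unfolding B by (intro prob_U order_trans[OF c(1) \<beta>(2)])
    finally have "real n0 * (\<beta> - 1 / 2 ^ k) \<le> real n0 * law.prob ?B"
      by (rule mult_left_mono) simp
    then have "real n0 * \<beta> - real n0 / 2 ^ k \<le> real n0 * law.prob ?B"
      by (simp add: right_diff_distrib)
    moreover have "dev n0 ?B \<omega> \<le> dev n (A x) \<omega> + (real n * \<beta> - real n0 * law.prob ?B)"
      unfolding \<beta>_def using n01 UA by (intro dev_le_mono) auto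
    moreover have "- \<tau> \<le> dev n0 ?B \<omega>"
      using grid[of a b U] a b_le by (auto simp: n0_def)
    ultimately show ?thesis using step_n step_c mean by (simp add: algebra_simps)
  qed
  show ?thesis using upper lower unfolding \<tau>_def i_def by linarith
qed

text \<open>Rays whose level \<open>j\<close> stays at least \<open>d\<close> below \<open>k\<close> are controlled by the grid, and there the
  bounded discretisation error is negligible against \<open>2 powr (\<alpha> * (k - j))\<close> once \<open>d\<close> is large. The
  other rays contain no observation at all, and their expected number of hits, suitably weighted,
  is at most a constant times a term of the summable dyadic tails, which tends to 0.\<close>

lemma weighted_dev_le:
  assumes \<alpha>: "1 / 2 < \<alpha>" "\<alpha> \<le> 1" and e: "0 < e"
  shows "AE \<omega> in M. \<forall>\<^sub>F n in sequentially. \<forall>x\<in>T.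
           real n powr (- \<alpha>) * W x powr \<alpha> * \<bar>dev n (A x) \<omega>\<bar> \<le> e"
proof -
  \<comment> \<open>The factor 4 is 2 for the width of a dyadic level times 2 for the two error terms
    (deviation on the grid and discretisation).\<close>
  define \<delta> where "\<delta> = e / 4"
  have \<delta>: "0 < \<delta>" using e by (simp add: \<delta>_def)
  obtain C where C: "1 \<le> C" "\<And>j. 2 ^ j * law.prob (heavy j) \<le> real C" using heavy_bounded by blast
  have "(\<lambda>d. (real C + 2) * 2 powr (- \<alpha> * real d)) \<longlonglongrightarrow> 0" using \<alpha> by real_asymp
  then have "\<forall>\<^sub>F d in sequentially. (real C + 2) * 2 powr (- \<alpha> * real d) < \<delta>"
    using \<delta> by (rule order_tendstoD)
  then obtain d where d: "\<And>i. d \<le> i \<Longrightarrow> (real C + 2) * 2 powr (- \<alpha> * real i) < \<delta>"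
    by (auto simp: eventually_sequentially)
  have "(\<lambda>j. 2 ^ j * law.prob (heavy j)) \<longlonglongrightarrow> 0" using summable_heavy by (rule summable_LIMSEQ_zero)
  then have "\<forall>\<^sub>F j in sequentially. 2 ^ j * law.prob (heavy j) < e / (2 * 2 ^ d)"
    by (rule order_tendstoD) (use e in auto)
  then obtain J where J: "\<And>j. J \<le> j \<Longrightarrow> 2 ^ j * law.prob (heavy j) < e / (2 * 2 ^ d)"
    by (auto simp: eventually_sequentially)
  show ?thesis
    using eventually_no_grid_exceedance[OF \<alpha>(1) \<delta> C] eventually_no_heavy_sample[of d] AE_space
  proof eventually_elim
    case (elim \<omega>)
    obtain K1 where K1: "\<And>k j. K1 \<le> k \<Longrightarrow> j \<le> k \<Longrightarrow> \<omega> \<notin> grid_exceedance \<alpha> \<delta> C k j"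
      using elim(1) by (auto simp: eventually_sequentially)
    obtain K2 where K2: "\<And>k i. K2 \<le> k \<Longrightarrow> 1 \<le> i \<Longrightarrow> i \<le> 2 ^ (k + 1) \<Longrightarrow> X i \<omega> \<notin> heavy (k - d)"
      using elim(2) by (auto simp: eventually_sequentially)
    define K where "K = K1 + K2 + J + d"
    show ?case unfolding eventually_sequentially
    proof (intro exI[of _ "2 ^ K"] allI impI ballI)
      fix n :: nat and x :: real assume n: "2 ^ K \<le> n" and x: "x \<in> T"
      have "1 \<le> n" using n one_le_power[of "2::nat" K] by linarith
      then obtain k where k: "2 ^ k \<le> n" "n < 2 ^ (k + 1)"
        using ex_power_ivl1[of 2 n] by auto
      have Kk: "K \<le> k"
      proof -
        have "(2::nat) ^ K < 2 ^ (k + 1)" using n k by linarith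
        then show ?thesis using power_less_imp_less_exp[of "2::nat" K "k + 1"] by simp
      qed
      obtain j where j: "2 ^ j \<le> W x" "W x < 2 ^ (j + 1)" using ex_dyadic_level[OF W_ge_1] .
      have n_real: "2 ^ k \<le> real n" "real n \<le> 2 ^ (k + 1)"
        using k of_nat_le_iff[of "2 ^ k" n, where ?'a = real] of_nat_le_iff[of n "2 ^ (k + 1)", where ?'a = real]
        by simp_all
      have W_powr: "W x powr \<alpha> \<le> 2 powr (\<alpha> * (real j + 1))"
      proof -
        have "W x powr \<alpha> \<le> (2 ^ (j + 1)) powr \<alpha>"
          using j \<alpha> W_ge_1[of x] by (intro powr_mono2) auto
        also have "\<dots> = 2 powr (\<alpha> * (real j + 1))"
          by (subst powr_realpow[symmetric]) (auto simp: powr_powr algebra_simps)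
        finally show ?thesis .
      qed
      show "real n powr (- \<alpha>) * W x powr \<alpha> * \<bar>dev n (A x) \<omega>\<bar> \<le> e"
      proof (cases "j + d \<le> k")
        case True
        define i where "i = k - j"
        have i: "d \<le> i" "j \<le> k" "real i = real k - real j" using True by (auto simp: i_def)
        have dev: "\<bar>dev n (A x) \<omega>\<bar> \<le> \<delta> * 2 powr (\<alpha> * real i) + (real C + 2)"
          unfolding i_def using elim(3) K1[of k j] Kk i(2) C(2) x j k
          by (intro dev_le_if_no_grid_exceedance) (auto simp: K_def)
        have "real n powr (- \<alpha>) \<le> (2 ^ k) powr (- \<alpha>)"
          using n_real \<alpha> by (intro powr_mono2') auto
        also have "\<dots> = 2 powr (- \<alpha> * real k)"
          by (subst powr_realpow[symmetric]) (auto simp: powr_powr mult_ac)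
        finally have "real n powr (- \<alpha>) * W x powr \<alpha> \<le> 2 powr (- \<alpha> * real k) * 2 powr (\<alpha> * (real j + 1))"
          using W_powr by (intro mult_mono) auto
        also have "\<dots> = 2 powr \<alpha> * 2 powr (- \<alpha> * real i)"
          unfolding powr_add[symmetric] i(3) by (simp add: algebra_simps)
        also have "\<dots> \<le> 2 * 2 powr (- \<alpha> * real i)"
          using \<alpha> powr_mono[of \<alpha> 1 2] by (intro mult_right_mono) auto
        finally have "real n powr (- \<alpha>) * W x powr \<alpha> * \<bar>dev n (A x) \<omega>\<bar>
            \<le> 2 * 2 powr (- \<alpha> * real i) * (\<delta> * 2 powr (\<alpha> * real i) + (real C + 2))"
          using dev by (rule mult_mono) auto
        also have "\<dots> = 2 * (\<delta> + (real C + 2) * 2 powr (- \<alpha> * real i))"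
          by (simp add: algebra_simps powr_minus)
        also have "\<dots> \<le> 2 * (\<delta> + \<delta>)" using d[OF i(1)] by simp
        finally show ?thesis by (simp add: \<delta>_def)
      next
        case False
        have AV: "A x \<subseteq> heavy j" using A_subset_heavy x j by blast
        also have "heavy j \<subseteq> heavy (k - d)" using False by (intro heavy_antimono) auto
        finally have sub: "A x \<subseteq> heavy (k - d)" .
        have "X i \<omega> \<notin> A x" if "1 \<le> i" "i \<le> n" for i
          using K2[of k i] Kk that k sub by (auto simp: K_def)
        then have "dev n (A x) \<omega> = - (real n * law.prob (A x))" by (simp add: dev_def)
        also have "\<bar>\<dots>\<bar> \<le> real n * law.prob (heavy j)"
          by (auto intro!: mult_left_mono law.finite_measure_mono[OF AV])
        finally have dev: "\<bar>dev n (A x) \<omega>\<bar> \<le> real n * law.prob (heavy j)" .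
        have "real n powr (- \<alpha>) * W x powr \<alpha> * \<bar>dev n (A x) \<omega>\<bar>
            \<le> real n powr (- \<alpha>) * 2 powr (\<alpha> * (real j + 1)) * (real n * law.prob (heavy j))"
          using W_powr dev by (intro mult_mono) auto
        also have "\<dots> = real n powr (1 - \<alpha>) * 2 powr (\<alpha> * (real j + 1)) * law.prob (heavy j)"
          using \<open>1 \<le> n\<close> by (simp add: powr_diff powr_minus field_simps)
        also have "real n powr (1 - \<alpha>) * 2 powr (\<alpha> * (real j + 1)) * law.prob (heavy j)
            \<le> 2 powr ((1 - \<alpha>) * (real j + real d + 1)) * 2 powr (\<alpha> * (real j + 1)) * law.prob (heavy j)"
        proof (intro mult_right_mono)
          have "real n powr (1 - \<alpha>) \<le> (2 ^ (k + 1)) powr (1 - \<alpha>)"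
            using n_real \<alpha> by (intro powr_mono2) auto
          also have "\<dots> = 2 powr ((1 - \<alpha>) * (real k + 1))"
            by (subst powr_realpow[symmetric]) (auto simp: powr_powr algebra_simps)
          also have "\<dots> \<le> 2 powr ((1 - \<alpha>) * (real j + real d + 1))"
            using False \<alpha> by (intro powr_mono mult_left_mono) auto
          finally show "real n powr (1 - \<alpha>) \<le> 2 powr ((1 - \<alpha>) * (real j + real d + 1))" .
        qed auto
        also have "2 powr ((1 - \<alpha>) * (real j + real d + 1)) * 2 powr (\<alpha> * (real j + 1))
            = 2 powr (real j + 1 + (1 - \<alpha>) * real d)"
          unfolding powr_add[symmetric] by (simp add: algebra_simps)
        also have "\<dots> \<le> 2 powr (real j + 1 + real d)"
          using \<alpha> by (intro powr_mono add_left_mono mult_left_le_one_le) auto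
        also have "\<dots> = 2 ^ j * (2 * 2 ^ d)"
          by (simp add: powr_add powr_realpow)
        finally have "real n powr (- \<alpha>) * W x powr \<alpha> * \<bar>dev n (A x) \<omega>\<bar>
            \<le> (2 * 2 ^ d) * (2 ^ j * law.prob (heavy j))"
          by (simp add: mult_ac mult_right_mono)
        also have "\<dots> \<le> (2 * 2 ^ d) * (e / (2 * 2 ^ d))"
          using J[of j] Kk False by (intro mult_left_mono) (auto simp: K_def)
        finally show ?thesis by simp
      qed
    qed
  qed
qed

end

section \<open>The weighted empirical process\<close>

lemma (in real_distribution) interval_measure_cdf: "interval_measure (cdf M) = M"
proof (rule cdf_unique)
  show "real_distribution (interval_measure (cdf M))"
    by (rule real_distribution_interval_measure)
       (auto intro: cdf_nondecreasing cdf_is_right_cont cdf_lim_at_bot cdf_lim_at_top_prob)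
  show "real_distribution M" by standard auto
  show "cdf (interval_measure (cdf M)) = cdf M"
    by (rule cdf_interval_measure)
       (auto intro: cdf_nondecreasing cdf_is_right_cont cdf_lim_at_bot)
qed

context iid_sample
begin

text \<open>The brackets are the two sides of the probability integral transform. The outer
  one uses closed rays because the closed ray of every point of \<open>{x<..}\<close> lies inside \<open>{x<..}\<close>, the
  inner one open rays because those of all points outside \<open>{x<..}\<close> contain \<open>{x<..}\<close>.\<close>

lemma weighted_chain_upper_rays:
  assumes "W \<in> borel_measurable borel" "\<And>y. 1 \<le> W y" "(\<integral>\<^sup>+ y. ennreal (W y) \<partial>\<mu>) < \<infinity>"
    and "mono_on {s..} W"
  shows "weighted_chain M X \<mu> W {s..} (\<lambda>x. {x<..})
    (\<lambda>c. {y. law.prob {y..} \<le> c}) (\<lambda>c. {y. law.prob {y<..} < c})"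
proof (unfold_locales, goal_cases)
  case (4 x y)
  then show ?case by (intro mono_onD[OF assms(4)]) auto
next
  case (9 x c)
  have "law.prob {y..} \<le> law.prob {x<..}" if "x < y" for y
    using that by (intro law.finite_measure_mono) auto
  then show ?case using 9 by fastforce
next
  case (10 x c)
  have "law.prob {x<..} \<le> law.prob {y<..}" if "y \<le> x" for y
    using that by (intro law.finite_measure_mono) auto
  then show ?case using 10 by (fastforce simp: not_le[symmetric])
qed (use assms law.ray_level_sets_borel law.prob_upper_ray_le law.prob_upper_ray_less_ge in auto)

lemma weighted_chain_lower_rays:
  assumes "W \<in> borel_measurable borel" "\<And>y. 1 \<le> W y" "(\<integral>\<^sup>+ y. ennreal (W y) \<partial>\<mu>) < \<infinity>"
    and "antimono_on {..s} W"
  shows "weighted_chain M X \<mu> W {..s} (\<lambda>x. {..x})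
    (\<lambda>c. {y. law.prob {..y} \<le> c}) (\<lambda>c. {y. law.prob {..<y} < c})"
proof (unfold_locales, goal_cases)
  case (4 x y)
  then show ?case using monotone_onD[OF assms(4), of y x] by auto
next
  case (9 x c)
  have "law.prob {..y} \<le> law.prob {..x}" if "y \<le> x" for y
    using that by (intro law.finite_measure_mono) auto
  then show ?case using 9 by fastforce
next
  case (10 x c)
  have "law.prob {..x} \<le> law.prob {..<y}" if "x < y" for y
    using that by (intro law.finite_measure_mono) auto
  then show ?case using 10 by (fastforce simp: not_less[symmetric])
qed (use assms law.ray_level_sets_borel law.prob_lower_ray_le law.prob_lower_ray_less_ge in auto)

lemma empirical_cdf_minus_cdf:
  assumes "1 \<le> n"
  shows "empirical_cdf X n \<omega> x - cdf \<mu> x = dev n {..x} \<omega> / real n"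
proof -
  have "indicat_real {X i \<omega>..} x = indicator {..x} (X i \<omega>)" for i
    by (simp add: indicator_def)
  then show ?thesis
    using assms by (simp add: empirical_cdf_def dev_def cdf_def diff_divide_distrib)
qed

lemma dev_greaterThan: "dev n {x<..} \<omega> = - dev n {..x} \<omega>"
proof -
  have ind: "indicat_real {x<..} y = 1 - indicat_real {..x} y" for y
    by (simp add: indicator_def)
  have prob: "law.prob {x<..} = 1 - law.prob {..x}"
    using law.prob_compl[of "{..x}"] by (simp add: Compl_eq_Diff_UNIV[symmetric])
  show ?thesis unfolding dev_def ind prob by (simp add: sum_subtractf right_diff_distrib)
qed

end

theorem theorem2p1:
  fixes M :: "'a measure" and X :: "nat \<Rightarrow> 'a \<Rightarrow> real"
    and F \<phi> :: "real \<Rightarrow> real" and r :: real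
  assumes "prob_space M"
    and "prob_space.indep_vars M (\<lambda>_. borel) X {1..}"
    and "\<And>i. i \<ge> 1 \<Longrightarrow> cdf (distr M borel (X i)) = F"
    and "weight_function \<phi>"
    and "0 \<le> r" and "r < 1 / 2"
    and "(\<integral>\<^sup>+ x. ennreal (\<phi> x powr (1 / (1 - r))) \<partial>(interval_measure F)) < \<infinity>"
  shows "AE \<omega> in M.
    (\<lambda>n. ennreal (real n powr r) * weighted_norm \<phi> (\<lambda>x. empirical_cdf X n \<omega> x - F x))
      \<longlonglongrightarrow> 0"
proof -
  interpret prob_space M by fact
  define \<mu> where "\<mu> = distr M borel (X 1)"
  have X_meas: "X i \<in> borel_measurable M" if "1 \<le> i" for i
    using assms(2) that by (auto simp: indep_vars_def)
  interpret iid_sample M X \<mu>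
  proof
    show "distr M borel (X i) = \<mu>" if "1 \<le> i" for i
      unfolding \<mu>_def using that assms(3)
      by (intro cdf_unique real_distribution_distr X_meas) auto
  qed fact
  have F: "F = cdf \<mu>" using assms(3)[of 1] by (simp add: \<mu>_def)
  obtain s where cont: "continuous_on UNIV \<phi>"
    and anti: "antimono_on {..s} \<phi>" and mono: "mono_on {s..} \<phi>"
    using assms(4) by (auto simp: weight_function_def)
  have \<phi>_nonneg: "0 \<le> \<phi> x" for x
    using assms(4) by (auto simp: weight_function_def) (meson less_imp_le order_trans)
  define \<alpha> where "\<alpha> = 1 - r"
  have \<alpha>: "1 / 2 < \<alpha>" "\<alpha> \<le> 1" using assms(5,6) by (auto simp: \<alpha>_def)
  \<comment> \<open>The weight is truncated below at 1 so that its dyadic level is a natural number, and raised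
    to the power \<open>1 / \<alpha>\<close> so that it is integrable.\<close>
  define W where "W y = max 1 (\<phi> y) powr (1 / \<alpha>)" for y
  have [measurable]: "\<phi> \<in> borel_measurable borel"
    using cont by (rule borel_measurable_continuous_onI)
  have W_meas: "W \<in> borel_measurable borel"
    unfolding W_def[abs_def] by measurable
  have W_ge: "1 \<le> W y" for y
    unfolding W_def using \<alpha> by (intro ge_one_powr_ge_zero) auto
  have W_mono: "W x \<le> W y" if "\<phi> x \<le> \<phi> y" for x y
    unfolding W_def using that \<alpha> by (intro powr_mono2) auto
  have W_powr: "\<phi> y \<le> W y powr \<alpha>" for y
    unfolding W_def using \<alpha> by (simp add: powr_powr)
  have W_int: "(\<integral>\<^sup>+ y. ennreal (W y) \<partial>\<mu>) < \<infinity>"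
  proof -
    have "W y \<le> 1 + \<phi> y powr (1 / \<alpha>)" for y
      by (auto simp: W_def max_def)
    then have "ennreal (W y) \<le> ennreal (1 + \<phi> y powr (1 / \<alpha>))" for y
      by (rule ennreal_leI)
    then have "(\<integral>\<^sup>+ y. ennreal (W y) \<partial>\<mu>) \<le> (\<integral>\<^sup>+ y. 1 + ennreal (\<phi> y powr (1 / \<alpha>)) \<partial>\<mu>)"
      by (intro nn_integral_mono) simp
    also have "\<dots> = 1 + (\<integral>\<^sup>+ y. ennreal (\<phi> y powr (1 / \<alpha>)) \<partial>\<mu>)"
      using law.emeasure_space_1 by (subst nn_integral_add) auto
    also have "\<dots> < \<infinity>"
      using assms(7) law.interval_measure_cdf by (simp add: F \<alpha>_def)
    finally show ?thesis .
  qed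
  \<comment> \<open>To the right of the minimum of \<open>\<phi>\<close> the upper rays shrink as the weight grows, to the left of
    it the lower rays do.\<close>
  interpret right: weighted_chain M X \<mu> W "{s..}" "\<lambda>x. {x<..}"
    "\<lambda>c. {y. law.prob {y..} \<le> c}" "\<lambda>c. {y. law.prob {y<..} < c}"
    using mono W_mono by (intro weighted_chain_upper_rays W_meas W_ge W_int) (auto simp: monotone_on_def)
  interpret left: weighted_chain M X \<mu> W "{..s}" "\<lambda>x. {..x}"
    "\<lambda>c. {y. law.prob {..y} \<le> c}" "\<lambda>c. {y. law.prob {..<y} < c}"
    using anti W_mono by (intro weighted_chain_lower_rays W_meas W_ge W_int) (auto simp: monotone_on_def)
  have pointwise: "\<bar>empirical_cdf X n \<omega> x - F x\<bar> * \<phi> x \<le> e * real n powr (- r)"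
    if n: "1 \<le> n"
      and right: "\<forall>x\<in>{s..}. real n powr (- \<alpha>) * W x powr \<alpha> * \<bar>dev n {x<..} \<omega>\<bar> \<le> e"
      and left: "\<forall>x\<in>{..s}. real n powr (- \<alpha>) * W x powr \<alpha> * \<bar>dev n {..x} \<omega>\<bar> \<le> e"
    for n \<omega> e x
  proof -
    have le: "real n powr (- \<alpha>) * W x powr \<alpha> * \<bar>dev n {..x} \<omega>\<bar> \<le> e"
      using right left by (cases "x \<le> s") (auto simp: dev_greaterThan)
    have "real n powr (- \<alpha>) = real n powr r / real n"
      using n by (simp add: \<alpha>_def powr_diff)
    then have "real n powr r * (\<bar>empirical_cdf X n \<omega> x - F x\<bar> * \<phi> x)
        = real n powr (- \<alpha>) * \<phi> x * \<bar>dev n {..x} \<omega>\<bar>"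
      using n by (simp add: F empirical_cdf_minus_cdf)
    also have "\<dots> \<le> real n powr (- \<alpha>) * W x powr \<alpha> * \<bar>dev n {..x} \<omega>\<bar>"
      using W_powr by (intro mult_right_mono mult_left_mono) auto
    finally have "real n powr r * (\<bar>empirical_cdf X n \<omega> x - F x\<bar> * \<phi> x) \<le> e"
      using le by linarith
    then show ?thesis using n by (simp add: powr_minus field_simps)
  qed
  have "AE \<omega> in M. \<forall>l. (\<forall>\<^sub>F n in sequentially. \<forall>x\<in>{s..}.
           real n powr (- \<alpha>) * W x powr \<alpha> * \<bar>dev n {x<..} \<omega>\<bar> \<le> inverse (real (Suc l)))
       \<and> (\<forall>\<^sub>F n in sequentially. \<forall>x\<in>{..s}.
           real n powr (- \<alpha>) * W x powr \<alpha> * \<bar>dev n {..x} \<omega>\<bar> \<le> inverse (real (Suc l)))"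
    unfolding AE_all_countable using \<alpha>
    by (intro allI AE_conjI right.weighted_dev_le left.weighted_dev_le) auto
  then show ?thesis
  proof eventually_elim
    case (elim \<omega>)
    show ?case
    proof (rule order_tendstoI)
      fix a :: ennreal assume "0 < a"
      then obtain b where b: "0 < b" "b < a" using dense by blast
      obtain e where e: "b = ennreal e" "0 < e"
        using b by (cases b) (auto simp: ennreal_less_zero_iff)
      obtain l where l: "inverse (real (Suc l)) < e" using reals_Archimedean[OF e(2)] by blast
      have "\<forall>\<^sub>F n in sequentially. (1::nat) \<le> n" by (rule eventually_ge_at_top)
      then show "\<forall>\<^sub>F n in sequentially.
          ennreal (real n powr r) * weighted_norm \<phi> (\<lambda>x. empirical_cdf X n \<omega> x - F x) < a"
        using elim[rule_format, of l, THEN conjunct1] elim[rule_format, of l, THEN conjunct2]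
      proof eventually_elim
        case (elim n)
        let ?e = "inverse (real (Suc l))"
        have "weighted_norm \<phi> (\<lambda>x. empirical_cdf X n \<omega> x - F x) \<le> ennreal (?e * real n powr (- r))"
          unfolding weighted_norm_def using elim
          by (intro SUP_least ennreal_leI pointwise) auto
        then have "ennreal (real n powr r) * weighted_norm \<phi> (\<lambda>x. empirical_cdf X n \<omega> x - F x)
            \<le> ennreal (real n powr r) * ennreal (?e * real n powr (- r))"
          by (rule mult_left_mono) auto
        also have "\<dots> = ennreal ?e"
        proof -
          have "real n powr r * (?e * real n powr (- r)) = ?e"
            using elim(1) by (simp add: powr_minus)
          then show ?thesis by (subst ennreal_mult[symmetric]) (simp_all del: of_nat_Suc)
        qed
        also have "\<dots> < a"
          using l e b by (metis ennreal_leI less_imp_le order.strict_trans1)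
        finally show ?case .
      qed
    qed auto
  qed
qed

end
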